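(* Let $I\subseteq\mathbb{R}$ be an open interval and, for integers $i,j\ge 0$, let $\mu_{i,j}(t)=-\mu_{j,i}(t)$ and $\beta_i(t)$ be real-valued smooth functions of $t\in I$. Set $Pf(i,j)=\mu_{i,j}$, $Pf(d_0,i)=\beta_i$, $Pf(d_1,i)=\beta_{i+1}$, $Pf(d_0,d_1)=0$, and assume $$\frac{d}{dt}Pf(d_0,i)=Pf(d_0,i+1)=Pf(d_1,i),\qquad \frac{d}{dt}Pf(i,j)=Pf(i+1,j)+Pf(i,j+1)=Pf(d_0,d_1,i,j).$$ Define $$\tau_{2n}(t)=Pf(0,1,\dots,2n-1),\qquad \tau_{2n+1}(t)=Pf(d_0,0,1,\dots,2n),$$ and assume $\tau_n\neq 0$ on $I$ for all $n\ge 0$. Then $$u_n=\frac{\tau_{n+1}\tau_{n-1}}{\tau_n^2},\qquad b_n=\frac{d}{dt}\log\tau_n$$ satisfy the Toda lattice of BKP type in $1+1$ dimension: $$\frac{d}{dt}u_n=u_n(b_{n+1}-2b_n+b_{n-1}),\qquad \frac{d}{dt}b_n=u_n(b_{n-1}-b_{n+1}),\qquad n=1,2,\dots$$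
   Context: Hirota's Pfaffian notation: given symbols $a_1,\dots,a_{2N}$ and prescribed entries $Pf(a_i,a_j)=-Pf(a_j,a_i)$, $Pf(a_1,\dots,a_{2N})$ denotes the Pfaffian of the $2N\times 2N$ skew-symmetric matrix with $(i,j)$ entry $Pf(a_i,a_j)$; the empty Pfaffian is $1$ (so $\tau_0=1$). In particular $Pf(d_0,d_1,i,j)=-Pf(d_0,i)Pf(d_1,j)+Pf(d_0,j)Pf(d_1,i)$ since $Pf(d_0,d_1)=0$. Here $\frac{d}{dt}\log\tau_n$ means $\tau_n'/\tau_n$. *)

theory Defs
  imports "HOL-Analysis.Analysis" "HOL-Combinatorics.Permutations"
begin

text \<open>
  The Pfaffian of the \<open>2N \<times> 2N\<close> skew-symmetric matrix with entries \<open>a i j\<close>, where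
  \<open>i, j < 2 * N\<close>. Summing over all permutations counts every perfect matching
  \<open>2\<^sup>N * N!\<close> times, hence the normalising factor.
\<close>

definition pfaffian :: "nat \<Rightarrow> (nat \<Rightarrow> nat \<Rightarrow> real) \<Rightarrow> real" where
  "pfaffian N a =
     (\<Sum>p | p permutes {..<2 * N}. of_int (sign p) * (\<Prod>k<N. a (p (2 * k)) (p (2 * k + 1))))
       / (2 ^ N * fact N)"

text \<open>
  Hirota's \<open>Pf(a\<^sub>1, \<dots>, a\<^sub>2\<^sub>N)\<close> for a list of symbols with prescribed entries \<open>e\<close>.
  It is only meaningful for lists of even length.
\<close>

definition hirota_pf :: "('s \<Rightarrow> 's \<Rightarrow> real) \<Rightarrow> 's list \<Rightarrow> real" where
  "hirota_pf e as = pfaffian (length as div 2) (\<lambda>i j. e (as ! i) (as ! j))"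

datatype symb = D0 | D1 | Idx nat

fun entry :: "(nat \<Rightarrow> nat \<Rightarrow> real \<Rightarrow> real) \<Rightarrow> (nat \<Rightarrow> real \<Rightarrow> real) \<Rightarrow> real \<Rightarrow> symb \<Rightarrow> symb \<Rightarrow> real"
  where
    "entry \<mu> \<beta> t (Idx i) (Idx j) = \<mu> i j t"
  | "entry \<mu> \<beta> t D0 (Idx i) = \<beta> i t"
  | "entry \<mu> \<beta> t (Idx i) D0 = - \<beta> i t"
  | "entry \<mu> \<beta> t D1 (Idx i) = \<beta> (i + 1) t"
  | "entry \<mu> \<beta> t (Idx i) D1 = - \<beta> (i + 1) t"
  | "entry \<mu> \<beta> t D0 D0 = 0"
  | "entry \<mu> \<beta> t D0 D1 = 0"
  | "entry \<mu> \<beta> t D1 D0 = 0"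
  | "entry \<mu> \<beta> t D1 D1 = 0"

definition Pf ::
    "(nat \<Rightarrow> nat \<Rightarrow> real \<Rightarrow> real) \<Rightarrow> (nat \<Rightarrow> real \<Rightarrow> real) \<Rightarrow> real \<Rightarrow> symb list \<Rightarrow> real" where
  "Pf \<mu> \<beta> t as = hirota_pf (entry \<mu> \<beta> t) as"

text \<open>
  For \<open>n = 2m\<close> the symbols are \<open>0, \<dots>, 2m - 1\<close>, for \<open>n = 2m + 1\<close> they are \<open>d\<^sub>0, 0, \<dots>, 2m\<close>;
  in both cases the indices form \<open>[0..<n]\<close>.
\<close>

definition tau ::
    "(nat \<Rightarrow> nat \<Rightarrow> real \<Rightarrow> real) \<Rightarrow> (nat \<Rightarrow> real \<Rightarrow> real) \<Rightarrow> nat \<Rightarrow> real \<Rightarrow> real" where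
  "tau \<mu> \<beta> n t =
     (if even n then Pf \<mu> \<beta> t (map Idx [0..<n]) else Pf \<mu> \<beta> t (D0 # map Idx [0..<n]))"

text \<open>Only used for \<open>n \<ge> 1\<close>, so the truncated subtraction \<open>n - 1\<close> is exact.\<close>

definition toda_u ::
    "(nat \<Rightarrow> nat \<Rightarrow> real \<Rightarrow> real) \<Rightarrow> (nat \<Rightarrow> real \<Rightarrow> real) \<Rightarrow> nat \<Rightarrow> real \<Rightarrow> real" where
  "toda_u \<mu> \<beta> n t = tau \<mu> \<beta> (n + 1) t * tau \<mu> \<beta> (n - 1) t / (tau \<mu> \<beta> n t)\<^sup>2"

text \<open>
  The logarithmic derivative is \<open>\<tau>\<^sub>n' / \<tau>\<^sub>n\<close>; the functions \<open>\<tau>\<^sub>n\<close> may be negative.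
\<close>

definition toda_b ::
    "(nat \<Rightarrow> nat \<Rightarrow> real \<Rightarrow> real) \<Rightarrow> (nat \<Rightarrow> real \<Rightarrow> real) \<Rightarrow> nat \<Rightarrow> real \<Rightarrow> real" where
  "toda_b \<mu> \<beta> n t = deriv (tau \<mu> \<beta> n) t / tau \<mu> \<beta> n t"

text \<open>Being infinitely differentiable; intended for open sets, where two-sided derivatives
  are the right notion.\<close>

definition smooth_on :: "real set \<Rightarrow> (real \<Rightarrow> real) \<Rightarrow> bool" where
  "smooth_on S f \<longleftrightarrow> (\<forall>k. \<forall>t\<in>S. (deriv ^^ k) f differentiable (at t))"

end

theory Submission
  imports Defs
begin

text \<open>
  The equation for \<open>u\<^sub>n\<close> only uses that \<open>u\<^sub>n\<close> is a quotient of tau functions. The one for \<open>b\<^sub>n\<close> is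
  the bilinear equation
  \<open>\<tau>\<^sub>n'' \<tau>\<^sub>n - (\<tau>\<^sub>n')\<^sup>2 = \<tau>\<^sub>n\<^sub>+\<^sub>1 \<tau>\<^sub>n\<^sub>-\<^sub>1' - \<tau>\<^sub>n\<^sub>+\<^sub>1' \<tau>\<^sub>n\<^sub>-\<^sub>1\<close>. The two expressions for the
  derivative of \<open>Pf(i,j)\<close> give two expressions for \<open>\<tau>\<^sub>n'\<close>: the shift rule replaces the last index
  \<open>n - 1\<close> by \<open>n\<close> (all other shifts produce a repeated symbol), while the rank two rule gives
  \<open>\<tau>\<^sub>2\<^sub>m' = Pf(d\<^sub>0,d\<^sub>1,0,\<dots>,2m-1)\<close> and \<open>\<tau>\<^sub>2\<^sub>m\<^sub>+\<^sub>1' = Pf(d\<^sub>1,0,\<dots>,2m)\<close>. Shifting the latter gives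
  \<open>\<tau>\<^sub>n''\<close>, and the bilinear equation becomes a Pfaffian Pluecker relation on
  \<open>d\<^sub>0, d\<^sub>1, n - 1, n\<close>.
\<close>

section \<open>Contractions and recursive Pfaffians\<close>

text \<open>
  In closed form this is \<open>\<Sum>j. (-1)\<^sup>j * \<phi> z\<^sub>j * f (zs without z\<^sub>j)\<close>; with \<open>\<phi> = e x\<close> and \<open>f\<close> the
  Pfaffian it is the expansion along the row of \<open>x\<close>.
\<close>

primrec contract :: "('s \<Rightarrow> real) \<Rightarrow> ('s list \<Rightarrow> real) \<Rightarrow> 's list \<Rightarrow> real" where
  "contract \<phi> f [] = 0"
| "contract \<phi> f (z # zs) = \<phi> z * f zs - contract \<phi> (\<lambda>ws. f (z # ws)) zs"

text \<open>Deletion shortens the list, so only shorter arguments of \<open>f\<close> matter; as a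
  congruence rule this lets the nested recursion of \<open>pf\<close> terminate.\<close>

lemma contract_cong [fundef_cong]:
  assumes "\<phi> = \<psi>" "xs = ys" "\<And>ws. length ws < length ys \<Longrightarrow> f ws = g ws"
  shows "contract \<phi> f xs = contract \<psi> g ys"
  unfolding assms(1,2) using assms(3)
proof (induction ys arbitrary: f g)
  case (Cons y ys)
  have "contract \<psi> (\<lambda>ws. f (y # ws)) ys = contract \<psi> (\<lambda>ws. g (y # ws)) ys"
  proof (rule Cons.IH)
    show "f (y # ws) = g (y # ws)" if "length ws < length ys" for ws
      by (rule Cons.prems) (use that in simp)
  qed
  moreover have "f ys = g ys" by (rule Cons.prems) simp
  ultimately show ?case by simp
qed simp

lemma contract_eq_0: "(\<And>z. z \<in> set xs \<Longrightarrow> \<phi> z = 0) \<Longrightarrow> contract \<phi> f xs = 0"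
  by (induction xs arbitrary: f) auto

lemma contract_add_fun: "contract \<phi> (\<lambda>ws. f ws + g ws) xs = contract \<phi> f xs + contract \<phi> g xs"
  by (induction xs arbitrary: f g) (auto simp: algebra_simps)

lemma contract_diff_fun: "contract \<phi> (\<lambda>ws. f ws - g ws) xs = contract \<phi> f xs - contract \<phi> g xs"
  by (induction xs arbitrary: f g) (auto simp: algebra_simps)

lemma contract_mult_fun: "contract \<phi> (\<lambda>ws. c * f ws) xs = c * contract \<phi> f xs"
  by (induction xs arbitrary: f) (auto simp: algebra_simps)

lemma contract_minus_fun: "contract \<phi> (\<lambda>ws. - f ws) xs = - contract \<phi> f xs"
  by (induction xs arbitrary: f) (auto simp: algebra_simps)

lemma contract_add_form: "contract (\<lambda>z. \<phi> z + \<psi> z) f xs = contract \<phi> f xs + contract \<psi> f xs"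
  by (induction xs arbitrary: f) (auto simp: algebra_simps)

lemma contract_diff_form: "contract (\<lambda>z. \<phi> z - \<psi> z) f xs = contract \<phi> f xs - contract \<psi> f xs"
  by (induction xs arbitrary: f) (auto simp: algebra_simps)

lemma contract_mult_form: "contract (\<lambda>z. \<phi> z * c) f xs = c * contract \<phi> f xs"
  by (induction xs arbitrary: f) (auto simp: algebra_simps)

lemma contract_minus_form: "contract (\<lambda>z. - \<phi> z) f xs = - contract \<phi> f xs"
  by (induction xs arbitrary: f) (auto simp: algebra_simps)

text \<open>Deleting two entries in either order leaves the same list, but deleting the earlier one
  first moves the later one by a position, hence the sign.\<close>

lemma contract_anticommute:
  "contract \<phi> (contract \<psi> f) xs = - contract \<psi> (contract \<phi> f) xs"
  by (induction xs arbitrary: f)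
    (simp_all add: contract_diff_fun contract_mult_fun)

fun pf :: "('s \<Rightarrow> 's \<Rightarrow> real) \<Rightarrow> 's list \<Rightarrow> real" where
  "pf e [] = 1"
| "pf e (x # xs) = contract (e x) (pf e) xs"

text \<open>Terms keeping \<open>x\<close> and \<open>y\<close> change sign by hypothesis; those
  deleting one of them trade places, and adjacent positions carry opposite signs.\<close>

lemma contract_swap:
  assumes "\<And>us vs. length us \<le> length xs \<Longrightarrow> f (us @ y # x # vs) = - f (us @ x # y # vs)"
  shows "contract \<phi> f (xs @ y # x # zs) = - contract \<phi> f (xs @ x # y # zs)"
  using assms
proof (induction xs arbitrary: f)
  case Nil
  from Nil[of "[]"] show ?case by (simp add: contract_minus_fun)
next
  case (Cons a xs)
  have "contract \<phi> (\<lambda>ws. f (a # ws)) (xs @ y # x # zs) = - contract \<phi> (\<lambda>ws. f (a # ws)) (xs @ x # y # zs)"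
    by (rule Cons.IH) (use Cons.prems[of "a # us" for us] in simp)
  moreover have "f (xs @ y # x # zs) = - f (xs @ x # y # zs)"
    using Cons.prems by simp
  ultimately show ?case by (simp add: algebra_simps)
qed

text \<open>With \<open>f\<close> and \<open>g\<close> Pfaffians, this is the source of all Pluecker relations.\<close>

lemma contract_exchange:
  assumes skew: "\<And>x y. e x y = - e y x"
  shows "contract (\<lambda>z. contract (e z) g ys) f xs = - contract (\<lambda>z. contract (e z) f xs) g ys"
proof (induction xs arbitrary: f)
  case Nil
  show ?case by (simp add: contract_eq_0)
next
  case (Cons x xs)
  have "contract (\<lambda>z. contract (e z) f (x # xs)) g ys
      = f xs * contract (\<lambda>z. e z x) g ys - contract (\<lambda>z. contract (e z) (\<lambda>ws. f (x # ws)) xs) g ys"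
    by (simp add: contract_diff_form contract_mult_form)
  moreover have "contract (\<lambda>z. e z x) g ys = - contract (e x) g ys"
    by (subst skew) (simp add: contract_minus_form)
  ultimately show ?case by (simp add: Cons.IH)
qed

section \<open>Antisymmetry and Pluecker relations of the recursive Pfaffian\<close>

context
  fixes e :: "'s \<Rightarrow> 's \<Rightarrow> real"
  assumes skew: "\<And>x y. e x y = - e y x"
begin

text \<open>At the front, expanding two rows leaves the skew entry \<open>e y x\<close> and an
  anticommuting double contraction; elsewhere, one row expansion shortens the prefix.\<close>

lemma pf_swap: "pf e (xs @ y # x # zs) = - pf e (xs @ x # y # zs)"
proof (induction "length xs" arbitrary: xs zs rule: less_induct)
  case less
  show ?case
  proof (cases xs)
    case Nil
    then show ?thesis
      using contract_anticommute[of "e y" "e x" "pf e" zs] skew[of y x]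
      by (simp add: algebra_simps)
  next
    case (Cons w ws)
    have "contract (e w) (pf e) (ws @ y # x # zs) = - contract (e w) (pf e) (ws @ x # y # zs)"
      by (rule contract_swap, rule less) (simp add: Cons)
    then show ?thesis using Cons by simp
  qed
qed

lemma pf_move: "pf e (us @ vs @ y # ws) = (- 1) ^ length vs * pf e (us @ y # vs @ ws)"
proof (induction vs arbitrary: ws rule: rev_induct)
  case (snoc x vs)
  have "pf e (us @ vs @ x # y # ws) = - pf e (us @ vs @ y # x # ws)"
    using pf_swap[of "us @ vs" x y ws] by simp
  then show ?case using snoc.IH[of "x # ws"] by simp
qed simp

lemma pf_transpose: "pf e (us @ x # vs @ y # ws) = - pf e (us @ y # vs @ x # ws)"
proof -
  have *: "pf e (us @ x # vs @ y # ws) = (- 1) ^ length vs * pf e (us @ x # y # vs @ ws)" for x y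
    using pf_move[of "us @ [x]" vs y ws] by simp
  have "pf e (us @ x # y # vs @ ws) = - pf e (us @ y # x # vs @ ws)" by (rule pf_swap)
  then show ?thesis unfolding *[of x y] *[of y x] by (simp only: mult_minus_right)
qed

lemma pf_eq_0:
  assumes "\<not> distinct xs"
  shows "pf e xs = 0"
proof -
  obtain us y vs ws where "xs = us @ y # vs @ y # ws"
    using not_distinct_decomp[OF assms] by auto
  then show ?thesis using pf_transpose[of us y vs y ws] by simp
qed

lemma pf_permute_list:
  assumes "p permutes {..<length xs}"
  shows "pf e (permute_list p xs) = sign p * pf e xs"
  using finite_lessThan assms
proof (induction p rule: permutes_rev_induct)
  case id
  show ?case by simp
next
  case (swap a b p)
  have swap_lt: "pf e (permute_list (Transposition.transpose a b) ys) = - pf e ys"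
    if "a < b" "b < length ys" for a b and ys :: "'s list"
  proof -
    define vs where "vs = take (b - Suc a) (drop (Suc a) ys)"
    have ys: "ys = take a ys @ ys ! a # vs @ ys ! b # drop (Suc b) ys"
      using that id_take_nth_drop[of a ys] id_take_nth_drop[of "b - Suc a" "drop (Suc a) ys"]
      by (simp add: vs_def)
    have len: "length vs = b - Suc a" using that by (simp add: vs_def)
    have "permute_list (Transposition.transpose a b) ys = take a ys @ ys ! b # vs @ ys ! a # drop (Suc b) ys"
    proof (rule nth_equalityI)
      fix i assume "i < length (permute_list (Transposition.transpose a b) ys)"
      then have i: "i < length ys" by simp
      then have "permute_list (Transposition.transpose a b) ys ! i = ys ! Transposition.transpose a b i"
        by (simp add: permute_list_def)
      also have "\<dots> = (take a ys @ ys ! b # vs @ ys ! a # drop (Suc b) ys) ! i"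
        using that i len
        by (auto simp: nth_append nth_Cons' Transposition.transpose_def vs_def not_less)
      finally show "permute_list (Transposition.transpose a b) ys ! i
          = (take a ys @ ys ! b # vs @ ys ! a # drop (Suc b) ys) ! i" .
    qed (use that len in simp)
    also have "pf e \<dots> = - pf e (take a ys @ ys ! a # vs @ ys ! b # drop (Suc b) ys)"
      by (rule pf_transpose)
    also have "take a ys @ ys ! a # vs @ ys ! b # drop (Suc b) ys = ys"
      by (rule ys[symmetric])
    finally show ?thesis .
  qed
  let ?t = "Transposition.transpose a b"
  have t: "?t permutes {..<length xs}" using swap.hyps by (simp add: permutes_swap_id)
  have "pf e (permute_list (p \<circ> ?t) xs) = - pf e (permute_list p xs)"
    using swap_lt[of a b "permute_list p xs"] swap_lt[of b a "permute_list p xs"] swap.hyps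
    by (cases "a < b") (auto simp: permute_list_compose[OF t] Transposition.transpose_commute)
  moreover have "sign (p \<circ> ?t) = - sign p"
    using swap.hyps t permutation_permutes by (subst sign_compose) (auto simp: sign_swap_id)
  ultimately show ?case using swap.IH by (simp only: of_int_minus mult_minus_left)
qed

text \<open>
  The next two identities come from \<open>contract_exchange\<close> for lists that overlap in \<open>as\<close>:
  all summands that repeat an element of \<open>as\<close> vanish.
\<close>

lemma pf_repeat: "z \<in> set as \<Longrightarrow> pf e (z # xs @ as) = 0"
  by (rule pf_eq_0) simp

lemma pf_exchange:
  "contract (\<lambda>z. pf e (z # ys)) (pf e) xs = - contract (\<lambda>z. pf e (z # xs)) (pf e) ys"
  unfolding pf.simps by (rule contract_exchange[OF skew])

lemma pf_pluecker_even:
  "pf e (w # x # as) * pf e (y # z # as) - pf e (w # y # as) * pf e (x # z # as)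
    + pf e (w # z # as) * pf e (x # y # as) = pf e as * pf e (w # x # y # z # as)"
proof -
  have [simp]: "contract (\<lambda>v. pf e (v # x # y # z # as)) f as = 0"
    "contract (\<lambda>v. pf e (v # w # as)) f as = 0" for f
    using pf_repeat[where xs = "[x, y, z]"] pf_repeat[where xs = "[w]"]
    by (simp_all add: contract_eq_0 del: pf.simps)
  have swap: "pf e (v # w # as) = - pf e (w # v # as)" for v
    by (rule pf_swap[of "[]", unfolded append_Nil])
  \<comment> \<open>Outside \<open>as\<close>, one list contributes only \<open>w\<close>, giving
    the right-hand side; the other contributes the three products.\<close>
  show ?thesis
    using pf_exchange[of "x # y # z # as" "w # as"] swap[of x] swap[of y] swap[of z]
    by (simp add: algebra_simps del: pf.simps)
qed

lemma pf_pluecker_odd: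
  "pf e (w # as) * pf e (x # y # z # as) - pf e (x # as) * pf e (w # y # z # as)
    + pf e (y # as) * pf e (w # x # z # as) - pf e (z # as) * pf e (w # x # y # as) = 0"
proof -
  have [simp]: "contract (\<lambda>v. pf e (v # w # x # y # z # as)) f as = 0"
    "contract (\<lambda>v. pf e (v # as)) f as = 0" for f
    using pf_repeat[where xs = "[w, x, y, z]"] pf_repeat[where xs = "[]"]
    by (simp_all add: contract_eq_0 del: pf.simps)
  show ?thesis
    using pf_exchange[of "w # x # y # z # as" as] by (simp add: algebra_simps del: pf.simps)
qed

end

section \<open>Agreement with the permutation sum\<close>

text \<open>Leaving \<open>F\<close> general allows a passage, row by row, from \<open>pf\<close> to
  the product in the permutation formula.\<close>

definition antisym_sum :: "'s list \<Rightarrow> ('s list \<Rightarrow> real) \<Rightarrow> real" where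
  "antisym_sum xs F = (\<Sum>p | p permutes {..<length xs}. of_int (sign p) * F (permute_list p xs))"

lemma antisym_sum_cong:
  "(\<And>ys. length ys = length xs \<Longrightarrow> F ys = G ys) \<Longrightarrow> antisym_sum xs F = antisym_sum xs G"
  by (simp add: antisym_sum_def)

lemma antisym_sum_diff: "antisym_sum xs (\<lambda>ys. F ys - G ys) = antisym_sum xs F - antisym_sum xs G"
  by (simp add: antisym_sum_def algebra_simps sum_subtractf)

lemma antisym_sum_transpose:
  assumes "i < length xs" "j < length xs" "i \<noteq> j"
  shows "antisym_sum xs (\<lambda>ys. F (permute_list (Transposition.transpose i j) ys)) = - antisym_sum xs F"
proof -
  let ?t = "Transposition.transpose i j"
  have t: "?t permutes {..<length xs}" using assms by (simp add: permutes_swap_id)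
  have "antisym_sum xs F
      = (\<Sum>p | p permutes {..<length xs}. of_int (sign (p \<circ> ?t)) * F (permute_list (p \<circ> ?t) xs))"
    unfolding antisym_sum_def by (rule sum_permutations_compose_right[OF t])
  also have "\<dots> = (\<Sum>p | p permutes {..<length xs}.
      - (of_int (sign p) * F (permute_list ?t (permute_list p xs))))"
  proof (rule sum.cong)
    fix p assume "p \<in> {p. p permutes {..<length xs}}"
    then have "sign (p \<circ> ?t) = - sign p"
      using t assms(3) permutation_permutes by (subst sign_compose) (auto simp: sign_swap_id)
    then show "of_int (sign (p \<circ> ?t)) * F (permute_list (p \<circ> ?t) xs)
        = - (of_int (sign p) * F (permute_list ?t (permute_list p xs)))"
      by (simp add: permute_list_compose[OF t])
  qed simp
  finally show ?thesis by (simp add: antisym_sum_def sum_negf)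
qed

text \<open>Under antisymmetrisation all terms of a contraction contribute equally.\<close>

lemma antisym_sum_contract:
  fixes e :: "'s \<Rightarrow> 's \<Rightarrow> real" and xs :: "'s list"
  assumes "k < i" "i + m = length xs"
  shows "antisym_sum xs (\<lambda>ys. contract (e (ys ! k)) (f (take i ys)) (drop i ys))
    = m * antisym_sum xs (\<lambda>ys. e (ys ! k) (ys ! i) * f (take i ys) (drop (Suc i) ys))"
  using assms
proof (induction m arbitrary: i f)
  case 0
  have "antisym_sum xs (\<lambda>ys. contract (e (ys ! k)) (f (take i ys)) (drop i ys)) = antisym_sum xs (\<lambda>ys. 0)"
    by (rule antisym_sum_cong) (use 0 in simp)
  then show ?case by (simp add: antisym_sum_def)
next
  case (Suc m)
  let ?H = "\<lambda>ys. e (ys ! k) (ys ! i) * f (take i ys) (drop (Suc i) ys)"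
  let ?G = "\<lambda>ys. e (ys ! k) (ys ! Suc i) * f (take i ys) (ys ! i # drop (Suc (Suc i)) ys)"
  \<comment> \<open>\<open>f'\<close> stores the entry skipped at position \<open>i\<close>, so that
    the induction hypothesis applies at \<open>Suc i\<close>.\<close>
  define f' where "f' vs ws = f (take i vs) (vs ! i # ws)" for vs ws
  have "antisym_sum xs (\<lambda>ys. contract (e (ys ! k)) (f (take i ys)) (drop i ys))
      = antisym_sum xs (\<lambda>ys. ?H ys - contract (e (ys ! k)) (f' (take (Suc i) ys)) (drop (Suc i) ys))"
  proof (rule antisym_sum_cong)
    fix ys :: "'s list"
    assume "length ys = length xs"
    then have "i < length ys" using Suc.prems by simp
    then have "drop i ys = ys ! i # drop (Suc i) ys" by (simp add: Cons_nth_drop_Suc)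
    then show "contract (e (ys ! k)) (f (take i ys)) (drop i ys)
        = ?H ys - contract (e (ys ! k)) (f' (take (Suc i) ys)) (drop (Suc i) ys)"
      by (simp add: f'_def[abs_def])
  qed
  moreover have "antisym_sum xs (\<lambda>ys. contract (e (ys ! k)) (f' (take (Suc i) ys)) (drop (Suc i) ys))
      = m * antisym_sum xs ?G"
    using Suc.IH[of "Suc i" f'] Suc.prems by (simp add: f'_def[abs_def])
  \<comment> \<open>Exchanging positions \<open>i\<close> and \<open>Suc i\<close> turns
    \<open>?G\<close> into \<open>?H\<close> with a sign; the latter position exists only for
    nonzero \<open>m\<close>.\<close>
  moreover have "m * antisym_sum xs ?G = - (m * antisym_sum xs ?H)"
  proof (cases "m = 0")
    case False
    have "antisym_sum xs ?G = antisym_sum xs (\<lambda>ys. ?H (permute_list (Transposition.transpose i (Suc i)) ys))"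
    proof (rule antisym_sum_cong)
      fix ys :: "'s list"
    assume "length ys = length xs"
      then have i: "Suc i < length ys" using Suc.prems False by simp
      let ?zs = "permute_list (Transposition.transpose i (Suc i)) ys"
      have nth: "?zs ! j = ys ! Transposition.transpose i (Suc i) j" if "j < length ys" for j
        using that by (simp add: permute_list_def)
      have "take i ?zs = take i ys"
        using i by (intro nth_equalityI) (auto simp: nth)
      moreover have "drop (Suc i) ?zs = ys ! i # drop (Suc (Suc i)) ys"
        using i by (intro nth_equalityI) (auto simp: nth nth_Cons' Transposition.transpose_def)
      moreover have "?zs ! k = ys ! k" "?zs ! i = ys ! Suc i"
        using i Suc.prems by (auto simp: nth)
      ultimately show "?G ys = ?H ?zs" by simp
    qed
    then show ?thesis
      using antisym_sum_transpose[of i xs "Suc i" ?H] Suc.prems False by simp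
  qed simp
  ultimately show ?case by (simp add: antisym_sum_diff algebra_simps)
qed

text \<open>After \<open>k\<close> row expansions the next row has \<open>2 * (N - k) - 1\<close>
  terms, all contributing equally.\<close>

lemma antisym_sum_pf:
  fixes e :: "'s \<Rightarrow> 's \<Rightarrow> real" and xs :: "'s list"
  assumes "length xs = 2 * N" "r \<le> N"
  shows "antisym_sum xs (pf e) = (\<Prod>k<r. 2 * real (N - k) - 1) *
    antisym_sum xs (\<lambda>ys. (\<Prod>k<r. e (ys ! (2 * k)) (ys ! (2 * k + 1))) * pf e (drop (2 * r) ys))"
  using assms(2)
proof (induction r)
  case (Suc r)
  define f where "f vs ws = (\<Prod>k<r. e (vs ! (2 * k)) (vs ! (2 * k + 1))) * pf e ws" for vs ws
  let ?i = "Suc (2 * r)"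
  have "antisym_sum xs (\<lambda>ys. (\<Prod>k<r. e (ys ! (2 * k)) (ys ! (2 * k + 1))) * pf e (drop (2 * r) ys))
      = antisym_sum xs (\<lambda>ys. contract (e (ys ! (2 * r))) (f (take ?i ys)) (drop ?i ys))"
  proof (rule antisym_sum_cong)
    fix ys :: "'s list"
    assume "length ys = length xs"
    then have "2 * r < length ys" using assms Suc.prems by simp
    then have "drop (2 * r) ys = ys ! (2 * r) # drop ?i ys" by (simp add: Cons_nth_drop_Suc)
    then show "(\<Prod>k<r. e (ys ! (2 * k)) (ys ! (2 * k + 1))) * pf e (drop (2 * r) ys)
        = contract (e (ys ! (2 * r))) (f (take ?i ys)) (drop ?i ys)"
      by (simp add: f_def[abs_def] contract_mult_fun)
  qed
  also have "\<dots> = (2 * real (N - r) - 1) *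
      antisym_sum xs (\<lambda>ys. e (ys ! (2 * r)) (ys ! ?i) * f (take ?i ys) (drop (Suc ?i) ys))"
    using antisym_sum_contract[of "2 * r" ?i "2 * (N - r) - 1" xs e f] assms Suc.prems
    by (simp add: of_nat_diff)
  also have "antisym_sum xs (\<lambda>ys. e (ys ! (2 * r)) (ys ! ?i) * f (take ?i ys) (drop (Suc ?i) ys))
      = antisym_sum xs (\<lambda>ys. (\<Prod>k<Suc r. e (ys ! (2 * k)) (ys ! (2 * k + 1))) * pf e (drop (2 * Suc r) ys))"
    by (rule antisym_sum_cong) (simp add: f_def)
  finally show ?case using Suc by simp
qed simp

text \<open>The antisymmetrised \<open>pf\<close> is computed twice: every permutation returns
  \<open>pf e xs\<close>, as its sign occurs squared, while full row expansion gives the permutation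
  sum times an odd double factorial.\<close>

lemma hirota_pf_eq_pf:
  assumes skew: "\<And>x y. e x y = - e y x" and even: "even (length xs)"
  shows "hirota_pf e xs = pf e xs"
proof -
  obtain N where N: "length xs = 2 * N" using even by blast
  have "antisym_sum xs (pf e) = (\<Sum>p | p permutes {..<length xs}. pf e xs)"
    unfolding antisym_sum_def
    by (rule sum.cong) (simp_all add: pf_permute_list[OF skew] flip: mult.assoc of_int_mult)
  then have 1: "antisym_sum xs (pf e) = fact (2 * N) * pf e xs"
    using card_permutations[of "{..<length xs}" "length xs"] by (simp add: N)
  have 2: "antisym_sum xs (pf e) = (\<Prod>k<N. 2 * real (N - k) - 1) *
      antisym_sum xs (\<lambda>ys. \<Prod>k<N. e (ys ! (2 * k)) (ys ! (2 * k + 1)))"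
    using antisym_sum_pf[OF N order_refl, of e]
      antisym_sum_cong[of xs "\<lambda>ys. (\<Prod>k<N. e (ys ! (2 * k)) (ys ! (2 * k + 1))) * pf e (drop (2 * N) ys)"
        "\<lambda>ys. \<Prod>k<N. e (ys ! (2 * k)) (ys ! (2 * k + 1))"]
    by (simp add: N)
  have 3: "antisym_sum xs (\<lambda>ys. \<Prod>k<N. e (ys ! (2 * k)) (ys ! (2 * k + 1)))
      = hirota_pf e xs * (2 ^ N * fact N)"
    by (simp add: antisym_sum_def hirota_pf_def pfaffian_def N permute_list_def)
  \<comment> \<open>In reverse order these are the odd factors of \<open>fact (2 * N)\<close>; the
    even ones make up \<open>2 ^ N * fact N\<close>.\<close>
  have "(\<Prod>k<N. 2 * real (N - k) - 1) = (\<Prod>k<N. 2 * real (Suc k) - 1)"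
    by (rule prod.reindex_bij_witness[where i = "\<lambda>k. N - Suc k" and j = "\<lambda>k. N - Suc k"]) auto
  also have "\<dots> * (2 ^ N * fact N) = fact (2 * N)"
  proof (induction N)
    case (Suc N)
    have "(\<Prod>k<Suc N. 2 * real (Suc k) - 1) * (2 ^ Suc N * fact (Suc N))
        = (2 * real N + 1) * (2 * real N + 2) *
          ((\<Prod>k<N. 2 * real (Suc k) - 1) * (2 ^ N * fact N))"
      by (simp add: algebra_simps)
    also have "\<dots> = (2 * real N + 1) * (2 * real N + 2) * fact (2 * N)"
      by (simp only: Suc.IH)
    finally show ?case by (simp add: algebra_simps)
  qed simp
  finally have 4: "(\<Prod>k<N. 2 * real (N - k) - 1) * (2 ^ N * fact N) = fact (2 * N)" .
  have "fact (2 * N) * hirota_pf e xs = (\<Prod>k<N. 2 * real (N - k) - 1) * (hirota_pf e xs * (2 ^ N * fact N))"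
    unfolding 4[symmetric] by (simp add: ac_simps)
  also have "\<dots> = fact (2 * N) * pf e xs"
    using 1 2 3 by simp
  finally have "fact (2 * N) * hirota_pf e xs = fact (2 * N) * pf e xs" .
  then show ?thesis by simp
qed

section \<open>Derivatives of Pfaffians\<close>

text \<open>The product rule; bounding \<open>ws\<close> by \<open>xs\<close> in entries and length
  suits induction along the Pfaffian recursion.\<close>

lemma contract_has_real_derivative:
  assumes "\<And>z. z \<in> set xs \<Longrightarrow> ((\<lambda>s. \<phi> s z) has_real_derivative \<phi>' z) (at t)"
    and "\<And>ws. set ws \<subseteq> set xs \<Longrightarrow> length ws \<le> length xs \<Longrightarrow>
      ((\<lambda>s. f s ws) has_real_derivative f' ws) (at t)"
  shows "((\<lambda>s. contract (\<phi> s) (f s) xs) has_real_derivative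
    contract \<phi>' (f t) xs + contract (\<phi> t) f' xs) (at t)"
  using assms
proof (induction xs arbitrary: f f')
  case (Cons z zs)
  have \<phi>: "((\<lambda>s. \<phi> s z) has_real_derivative \<phi>' z) (at t)"
    by (rule Cons.prems(1)) simp
  have f: "((\<lambda>s. f s zs) has_real_derivative f' zs) (at t)"
    by (rule Cons.prems(2)) auto
  have "((\<lambda>s. contract (\<phi> s) (\<lambda>ws. f s (z # ws)) zs) has_real_derivative
      contract \<phi>' (\<lambda>ws. f t (z # ws)) zs + contract (\<phi> t) (\<lambda>ws. f' (z # ws)) zs) (at t)"
  proof (rule Cons.IH)
    show "((\<lambda>s. f s (z # ws)) has_real_derivative f' (z # ws)) (at t)"
      if "set ws \<subseteq> set zs" "length ws \<le> length zs" for ws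
      by (rule Cons.prems(2)) (use that in auto)
  qed (use Cons.prems(1) in simp)
  from DERIV_diff[OF DERIV_mult[OF \<phi> f] this] show ?case
    by (simp add: algebra_simps)
qed simp

text \<open>
  The weight \<open>w\<close> is \<open>1\<close> on the symbols that the derivative shifts and \<open>0\<close> on \<open>d\<^sub>0, d\<^sub>1\<close>.
\<close>

primrec shift_sum ::
    "('s \<Rightarrow> real) \<Rightarrow> ('s \<Rightarrow> 's) \<Rightarrow> ('s list \<Rightarrow> real) \<Rightarrow> 's list \<Rightarrow> real" where
  "shift_sum w \<sigma> f [] = 0"
| "shift_sum w \<sigma> f (x # xs) = w x * f (\<sigma> x # xs) + shift_sum w \<sigma> (\<lambda>ws. f (x # ws)) xs"

lemma shift_sum_diff:
  "shift_sum w \<sigma> (\<lambda>ws. f ws - g ws) xs = shift_sum w \<sigma> f xs - shift_sum w \<sigma> g xs"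
  by (induction xs arbitrary: f g) (auto simp: algebra_simps)

lemma shift_sum_mult: "shift_sum w \<sigma> (\<lambda>ws. c * f ws) xs = c * shift_sum w \<sigma> f xs"
  by (induction xs arbitrary: f) (auto simp: algebra_simps)

text \<open>A Leibniz rule: a shift hits either the deleted entry, hence \<open>\<phi>\<close>, or a
  remaining one, and never alters the sign of the deletion.\<close>

lemma shift_sum_contract:
  "shift_sum w \<sigma> (contract \<phi> f) xs
    = contract (\<lambda>z. w z * \<phi> (\<sigma> z)) f xs + contract \<phi> (shift_sum w \<sigma> f) xs"
proof (induction xs arbitrary: f)
  case (Cons x xs)
  show ?case
    by (simp add: Cons.IH shift_sum_diff shift_sum_mult contract_add_fun contract_mult_fun)
      (simp add: algebra_simps)
qed simp

lemma pf_has_real_derivative_shift: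
  assumes "\<And>x y. ((\<lambda>s. e s x y) has_real_derivative w x * e t (\<sigma> x) y + w y * e t x (\<sigma> y)) (at t)"
  shows "((\<lambda>s. pf (e s) xs) has_real_derivative shift_sum w \<sigma> (pf (e t)) xs) (at t)"
proof (induction "length xs" arbitrary: xs rule: less_induct)
  case less
  show ?case
  proof (cases xs)
    case (Cons x ys)
    have "((\<lambda>s. contract (e s x) (pf (e s)) ys) has_real_derivative
        contract (\<lambda>z. w x * e t (\<sigma> x) z + w z * e t x (\<sigma> z)) (pf (e t)) ys
        + contract (e t x) (shift_sum w \<sigma> (pf (e t))) ys) (at t)"
      by (rule contract_has_real_derivative, rule assms, rule less) (simp add: Cons)
    moreover have "contract (\<lambda>z. w x * e t (\<sigma> x) z) (pf (e t)) ys
        = w x * contract (e t (\<sigma> x)) (pf (e t)) ys"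
      using contract_mult_form[of "e t (\<sigma> x)" "w x"] by (simp add: mult.commute)
    ultimately show ?thesis
      by (simp add: Cons shift_sum_contract contract_add_form add.assoc)
  qed simp
qed

text \<open>Shifting \<open>g i\<close> with \<open>i < n\<close> duplicates its successor, so only
  the shift of the last symbol survives.\<close>

lemma shift_sum_chain:
  assumes "\<And>ws. \<not> distinct ws \<Longrightarrow> f ws = 0"
    and "\<And>i. w (g i) = 1" "\<And>i. \<sigma> (g i) = g (Suc i)" and "k \<le> n"
  shows "shift_sum w \<sigma> f (map g [k..<Suc n]) = f (map g [k..<n] @ [g (Suc n)])"
  using assms(4,1)
proof (induction k arbitrary: f rule: inc_induct)
  case base
  show ?case using assms(2,3) by simp
next
  case (step k)
  have "shift_sum w \<sigma> f (map g [k..<Suc n])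
      = f (g (Suc k) # map g [Suc k..<Suc n])
        + shift_sum w \<sigma> (\<lambda>ws. f (g k # ws)) (map g [Suc k..<Suc n])"
    using step.hyps assms(2,3) by (simp add: upt_conv_Cons del: upt_Suc)
  also have "f (g (Suc k) # map g [Suc k..<Suc n]) = 0"
    by (rule step.prems) (use step.hyps in \<open>simp add: upt_conv_Cons del: upt_Suc\<close>)
  also have "shift_sum w \<sigma> (\<lambda>ws. f (g k # ws)) (map g [Suc k..<Suc n])
      = f (g k # map g [Suc k..<n] @ [g (Suc n)])"
    by (rule step.IH) (simp add: step.prems)
  finally show ?case
    using step.hyps by (simp add: upt_conv_Cons)
qed

text \<open>The derivative is the Pfaffian with two symbols of rows \<open>a\<close> and
  \<open>b\<close>, paired to 0, put in front. \<open>S\<close> will consist of the plain indices,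
  since pairings with \<open>D0\<close> have another derivative.\<close>

lemma pf_has_real_derivative_rank2:
  assumes e: "\<And>x y. x \<in> S \<Longrightarrow> y \<in> S \<Longrightarrow>
      ((\<lambda>s. e s x y) has_real_derivative a y * b x - a x * b y) (at t)"
    and "set xs \<subseteq> S"
  shows "((\<lambda>s. pf (e s) xs) has_real_derivative - contract a (contract b (pf (e t))) xs) (at t)"
  using assms(2)
proof (induction "length xs" arbitrary: xs rule: less_induct)
  case less
  show ?case
  proof (cases xs)
    case (Cons x ys)
    let ?P = "pf (e t)" and ?c = "contract (e t x)"
    have "((\<lambda>s. contract (e s x) (pf (e s)) ys) has_real_derivative
        contract (\<lambda>y. a y * b x - a x * b y) ?P ys
        + ?c (\<lambda>ws. - contract a (contract b ?P) ws) ys) (at t)"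
    proof (rule contract_has_real_derivative)
      show "((\<lambda>s. pf (e s) ws) has_real_derivative - contract a (contract b ?P) ws) (at t)"
        if "set ws \<subseteq> set ys" "length ws \<le> length ys" for ws
        using less that Cons by auto
    qed (use e less.prems Cons in auto)
    moreover have "contract (\<lambda>y. a x * b y) ?P ys = a x * contract b ?P ys"
      using contract_mult_form[of b "a x"] by (simp add: mult.commute)
    \<comment> \<open>The row contraction passes both others, and its two sign changes
      cancel.\<close>
    moreover have "?c (contract a (contract b ?P)) ys = contract a (contract b (?c ?P)) ys"
      using contract_anticommute[of "e t x" a] contract_anticommute[of "e t x" b, abs_def]
      by (simp add: contract_minus_fun)
    ultimately show ?thesis
      by (simp add: Cons contract_diff_form contract_mult_form contract_minus_fun
          contract_diff_fun contract_mult_fun algebra_simps)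
  qed simp
qed

section \<open>The tau functions\<close>

lemma entry_skewI:
  assumes "\<And>i j. \<mu> i j t = - \<mu> j i t"
  shows "entry \<mu> \<beta> t x y = - entry \<mu> \<beta> t y x"
proof (cases x; cases y)
  fix i j assume "x = Idx i" "y = Idx j"
  then show ?thesis using assms[of i j] by simp
qed simp_all

text \<open>The two derivatives of \<open>\<mu> i j\<close> are kept apart: one drives the shift
  rule, the other the rank two rule.\<close>

locale bkp_moments =
  fixes I :: "real set"
    and \<mu> :: "nat \<Rightarrow> nat \<Rightarrow> real \<Rightarrow> real"
    and \<beta> :: "nat \<Rightarrow> real \<Rightarrow> real"
  assumes open_I: "open I"
    and skew: "t \<in> I \<Longrightarrow> \<mu> i j t = - \<mu> j i t"
    and beta_deriv: "t \<in> I \<Longrightarrow> (\<beta> i has_real_derivative \<beta> (Suc i) t) (at t)"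
    and mu_deriv_shift: "t \<in> I \<Longrightarrow>
      (\<mu> i j has_real_derivative \<mu> (Suc i) j t + \<mu> i (Suc j) t) (at t)"
    and mu_deriv_rank2: "t \<in> I \<Longrightarrow>
      (\<mu> i j has_real_derivative \<beta> j t * \<beta> (Suc i) t - \<beta> i t * \<beta> (Suc j) t) (at t)"
begin

abbreviation P :: "real \<Rightarrow> symb list \<Rightarrow> real" where
  "P t \<equiv> pf (entry \<mu> \<beta> t)"

abbreviation idx :: "nat \<Rightarrow> symb list" where
  "idx n \<equiv> map Idx [0..<n]"

lemma entry_skew: "t \<in> I \<Longrightarrow> entry \<mu> \<beta> t x y = - entry \<mu> \<beta> t y x"
  by (rule entry_skewI) (rule skew)

text \<open>Differentiating a pairing with \<open>D0\<close> or \<open>D1\<close> also raises its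
  index, so one shift rule covers all entries once these symbols get weight 0.\<close>

lemma P_shift:
  assumes t: "t \<in> I" and us: "set us \<subseteq> {D0, D1}"
  shows "((\<lambda>s. P s (us @ idx (Suc m))) has_real_derivative P t (us @ idx m @ [Idx (Suc m)])) (at t)"
proof -
  define w :: "symb \<Rightarrow> real" where "w x = (case x of Idx i \<Rightarrow> 1 | _ \<Rightarrow> 0)" for x
  define \<sigma> where "\<sigma> x = (case x of Idx i \<Rightarrow> Idx (Suc i) | _ \<Rightarrow> x)" for x
  have "((\<lambda>s. entry \<mu> \<beta> s x y) has_real_derivative
      w x * entry \<mu> \<beta> t (\<sigma> x) y + w y * entry \<mu> \<beta> t x (\<sigma> y)) (at t)" for x y
    using beta_deriv[OF t] DERIV_minus[OF beta_deriv[OF t]] mu_deriv_shift[OF t]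
    by (cases x; cases y) (simp_all add: w_def \<sigma>_def)
  then have "((\<lambda>s. P s (us @ idx (Suc m))) has_real_derivative
      shift_sum w \<sigma> (P t) (us @ idx (Suc m))) (at t)"
    by (rule pf_has_real_derivative_shift)
  also have "shift_sum w \<sigma> f (us @ xs) = shift_sum w \<sigma> (\<lambda>ws. f (us @ ws)) xs" for f xs
    using us by (induction us arbitrary: f) (auto simp: w_def)
  also have "shift_sum w \<sigma> (\<lambda>ws. P t (us @ ws)) (idx (Suc m)) = P t (us @ idx m @ [Idx (Suc m)])"
  proof (rule shift_sum_chain)
    show "P t (us @ ws) = 0" if "\<not> distinct ws" for ws
      by (rule pf_eq_0[OF entry_skew[OF t]]) (use that in simp)
  qed (simp_all add: w_def \<sigma>_def)
  finally show ?thesis .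
qed

lemma P_idx_deriv:
  assumes t: "t \<in> I" and xs: "set xs \<subseteq> range Idx"
  shows "((\<lambda>s. P s xs) has_real_derivative P t (D0 # D1 # xs)) (at t)"
proof -
  have "((\<lambda>s. P s xs) has_real_derivative
      - contract (entry \<mu> \<beta> t D0) (contract (entry \<mu> \<beta> t D1) (P t)) xs) (at t)"
    by (rule pf_has_real_derivative_rank2[OF _ xs]) (auto intro: mu_deriv_rank2[OF t])
  \<comment> \<open>As \<open>D0\<close> and \<open>D1\<close> pair to 0, the double contraction is
    the expansion along their rows.\<close>
  then show ?thesis by simp
qed

lemma P_D0_idx_deriv:
  assumes t: "t \<in> I" and xs: "set xs \<subseteq> range Idx"
  shows "((\<lambda>s. P s (D0 # xs)) has_real_derivative P t (D1 # xs)) (at t)"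
proof -
  let ?a = "entry \<mu> \<beta> t D0" and ?b = "entry \<mu> \<beta> t D1"
  have "((\<lambda>s. contract (entry \<mu> \<beta> s D0) (P s) xs) has_real_derivative
      contract ?b (P t) xs + contract ?a (\<lambda>ws. P t (D0 # D1 # ws)) xs) (at t)"
  proof (rule contract_has_real_derivative)
    show "((\<lambda>s. entry \<mu> \<beta> s D0 z) has_real_derivative entry \<mu> \<beta> t D1 z) (at t)" if "z \<in> set xs" for z
      using that xs beta_deriv[OF t] by auto
    show "((\<lambda>s. P s ws) has_real_derivative P t (D0 # D1 # ws)) (at t)" if "set ws \<subseteq> set xs" for ws
      by (rule P_idx_deriv[OF t]) (use that xs in auto)
  qed
  \<comment> \<open>Up to sign this is a Pfaffian with \<open>D0\<close> repeated: \<open>?a\<close>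
    anticommutes with itself.\<close>
  moreover have "contract ?a (\<lambda>ws. P t (D0 # D1 # ws)) xs = 0"
    using contract_anticommute[of ?a ?a "contract ?b (P t)" xs] by (simp add: contract_minus_fun)
  ultimately show ?thesis by simp
qed

definition dtau :: "nat \<Rightarrow> real \<Rightarrow> real" where
  "dtau n t = (if even n then P t (D0 # D1 # idx n) else P t (D1 # idx n))"

lemma tau_eq:
  assumes "t \<in> I"
  shows "tau \<mu> \<beta> n t = (if even n then P t (idx n) else P t (D0 # idx n))"
  using hirota_pf_eq_pf[of "entry \<mu> \<beta> t", OF entry_skew[OF assms]]
  by (simp add: tau_def Pf_def del: pf.simps)

lemma has_real_derivative_cong_I:
  assumes "t \<in> I" "\<And>s. s \<in> I \<Longrightarrow> f s = g s" "(g has_real_derivative D) (at t)"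
  shows "(f has_real_derivative D) (at t)"
  using has_field_derivative_transform_within_open[OF assms(3) open_I assms(1)] assms(2) by metis

lemma tau_deriv:
  assumes "t \<in> I"
  shows "(tau \<mu> \<beta> n has_real_derivative dtau n t) (at t)"
proof (rule has_real_derivative_cong_I[OF assms tau_eq])
  show "((\<lambda>s. if even n then P s (idx n) else P s (D0 # idx n)) has_real_derivative dtau n t) (at t)"
    using P_idx_deriv[OF assms, of "idx n"] P_D0_idx_deriv[OF assms, of "idx n"]
    by (auto simp: dtau_def simp del: pf.simps)
qed

text \<open>Uniqueness of the derivative equates the rank two form, chosen for \<open>dtau\<close>,
  with the shift form.\<close>

lemma dtau_eq:
  assumes t: "t \<in> I"
  shows "dtau (Suc m) t
    = (if odd m then P t (idx m @ [Idx (Suc m)]) else P t (D0 # idx m @ [Idx (Suc m)]))"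
proof (rule DERIV_unique[OF tau_deriv[OF t]], rule has_real_derivative_cong_I[OF t tau_eq])
  show "((\<lambda>s. if even (Suc m) then P s (idx (Suc m)) else P s (D0 # idx (Suc m)))
      has_real_derivative
        (if odd m then P t (idx m @ [Idx (Suc m)]) else P t (D0 # idx m @ [Idx (Suc m)]))) (at t)"
    using P_shift[OF t, of "[]" m] P_shift[OF t, of "[D0]" m] by (auto simp del: pf.simps upt_Suc)
qed

text \<open>The second derivative of the tau function with index \<open>m + 1\<close>, not \<open>m\<close>.\<close>

definition ddtau :: "nat \<Rightarrow> real \<Rightarrow> real" where
  "ddtau m t = (if odd m then P t (D0 # D1 # idx m @ [Idx (Suc m)]) else P t (D1 # idx m @ [Idx (Suc m)]))"

lemma dtau_deriv:
  assumes t: "t \<in> I"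
  shows "(dtau (Suc m) has_real_derivative ddtau m t) (at t)"
  unfolding dtau_def[abs_def] ddtau_def
  using P_shift[OF t, of "[D0, D1]" m] P_shift[OF t, of "[D1]" m]
  by (auto simp del: pf.simps upt_Suc)

lemma tau_bilinear:
  assumes t: "t \<in> I"
  shows "ddtau m t * tau \<mu> \<beta> (Suc m) t - (dtau (Suc m) t)\<^sup>2
    = tau \<mu> \<beta> (Suc (Suc m)) t * dtau m t - dtau (Suc (Suc m)) t * tau \<mu> \<beta> m t"
proof -
  let ?A = "idx m" and ?y = "Idx m" and ?z = "Idx (Suc m)"
  have idx: "idx (Suc m) = ?A @ [?y]" "idx (Suc (Suc m)) = ?A @ [?y, ?z]" by simp_all
  let ?e = "entry \<mu> \<beta> t"
  note mv0 = pf_move[of ?e, OF entry_skew[OF t]]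
  \<comment> \<open>One trailing symbol crosses \<open>m\<close> indices; for two of them the signs
    cancel.\<close>
  have mv: "P t (us @ ?A @ [v]) = (- 1) ^ m * P t (us @ v # ?A)" for us v
    using mv0[of us ?A v "[]"] by simp
  have mv2: "P t (us @ ?A @ [?y, ?z]) = P t (us @ ?y # ?z # ?A)" for us
    using mv0[of us ?A ?y "[?z]"] mv0[of "us @ [?y]" ?A ?z "[]"]
    by (simp flip: mult.assoc power_add)
  note mvs = mv[of "[]"] mv[of "[D0]"] mv[of "[D1]"] mv[of "[D0, D1]"]
    mv2[of "[]"] mv2[of "[D0]"] mv2[of "[D1]"] mv2[of "[D0, D1]"]
  note mvs = mvs[unfolded append_Cons append_Nil]
  \<comment> \<open>One factor is put in shift form and the other in rank two form, the mixed
    product that occurs in the Pluecker relations.\<close>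
  have sq: "(dtau (Suc m) t)\<^sup>2 = (if odd m then P t (idx m @ [?z]) * P t (D0 # D1 # idx (Suc m))
      else P t (D0 # idx m @ [?z]) * P t (D1 # idx (Suc m)))"
    unfolding power2_eq_square
    by (subst dtau_eq[OF t], subst dtau_def) (simp del: pf.simps upt_Suc)
  show ?thesis
  \<comment> \<open>Each Pfaffian takes an even number of symbols, so the parity of the shared block
    \<open>?A\<close> selects the Pluecker relation.\<close>
  proof (cases "even m")
    case True
    then show ?thesis
      unfolding sq using pf_pluecker_even[of ?e, OF entry_skew[OF t], of D0 D1 ?A ?y ?z]
      by (simp add: tau_eq[OF t] dtau_def ddtau_def idx mvs algebra_simps del: pf.simps upt_Suc)
  next
    case False
    then show ?thesis
      unfolding sq using pf_pluecker_odd[of ?e, OF entry_skew[OF t], of D0 ?A D1 ?y ?z]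
      by (simp add: tau_eq[OF t] dtau_def ddtau_def idx mvs algebra_simps del: pf.simps upt_Suc)
  qed
qed

section \<open>The two Toda equations\<close>

lemma toda_b_eq: "t \<in> I \<Longrightarrow> toda_b \<mu> \<beta> n t = dtau n t / tau \<mu> \<beta> n t"
  using DERIV_imp_deriv[OF tau_deriv] by (simp add: toda_b_def)

lemma toda_u_deriv:
  assumes t: "t \<in> I" and nz: "\<And>n. tau \<mu> \<beta> n t \<noteq> 0"
  shows "(toda_u \<mu> \<beta> n has_real_derivative
    toda_u \<mu> \<beta> n t * (toda_b \<mu> \<beta> (n + 1) t - 2 * toda_b \<mu> \<beta> n t + toda_b \<mu> \<beta> (n - 1) t)) (at t)"
  unfolding toda_u_def[abs_def] toda_b_eq[OF t]
  by (rule derivative_eq_intros tau_deriv[OF t] refl | simp add: nz)+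
    (simp add: nz field_simps power2_eq_square power4_eq_xxxx)

lemma toda_b_deriv:
  assumes t: "t \<in> I" and "n \<ge> 1" and nz: "\<And>n. tau \<mu> \<beta> n t \<noteq> 0"
  shows "(toda_b \<mu> \<beta> n has_real_derivative
    toda_u \<mu> \<beta> n t * (toda_b \<mu> \<beta> (n - 1) t - toda_b \<mu> \<beta> (n + 1) t)) (at t)"
proof (rule has_real_derivative_cong_I[OF t toda_b_eq])
  obtain m where n: "n = Suc m" using \<open>n \<ge> 1\<close> by (cases n) auto
  have "((\<lambda>s. dtau n s / tau \<mu> \<beta> n s) has_real_derivative
      (ddtau m t * tau \<mu> \<beta> n t - dtau n t * dtau n t) / (tau \<mu> \<beta> n t * tau \<mu> \<beta> n t)) (at t)"
    unfolding n by (rule DERIV_divide[OF dtau_deriv[OF t] tau_deriv[OF t] nz])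
  also have "ddtau m t * tau \<mu> \<beta> n t - dtau n t * dtau n t
      = tau \<mu> \<beta> (n + 1) t * dtau (n - 1) t - dtau (n + 1) t * tau \<mu> \<beta> (n - 1) t"
    using tau_bilinear[OF t, of m] by (simp add: n power2_eq_square)
  also have "\<dots> / (tau \<mu> \<beta> n t * tau \<mu> \<beta> n t)
      = toda_u \<mu> \<beta> n t * (toda_b \<mu> \<beta> (n - 1) t - toda_b \<mu> \<beta> (n + 1) t)"
    using nz by (simp add: toda_b_eq[OF t] toda_u_def power2_eq_square field_simps)
  finally show "((\<lambda>s. dtau n s / tau \<mu> \<beta> n s) has_real_derivative
      toda_u \<mu> \<beta> n t * (toda_b \<mu> \<beta> (n - 1) t - toda_b \<mu> \<beta> (n + 1) t)) (at t)" .
qed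

end

theorem theorem3p19:
  fixes I :: "real set"
    and \<mu> :: "nat \<Rightarrow> nat \<Rightarrow> real \<Rightarrow> real"
    and \<beta> :: "nat \<Rightarrow> real \<Rightarrow> real"
  assumes "open I" and "is_interval I"
    and "\<And>i j. smooth_on I (\<mu> i j)"
    and "\<And>i. smooth_on I (\<beta> i)"
    and "\<And>i j t. t \<in> I \<Longrightarrow> \<mu> i j t = - \<mu> j i t"
    and "\<And>i t. t \<in> I \<Longrightarrow>
          ((\<lambda>s. entry \<mu> \<beta> s D0 (Idx i)) has_real_derivative entry \<mu> \<beta> t D0 (Idx (i + 1))) (at t)"
    and "\<And>i t. t \<in> I \<Longrightarrow> entry \<mu> \<beta> t D0 (Idx (i + 1)) = entry \<mu> \<beta> t D1 (Idx i)"
    and "\<And>i j t. t \<in> I \<Longrightarrow>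
          ((\<lambda>s. entry \<mu> \<beta> s (Idx i) (Idx j)) has_real_derivative
             entry \<mu> \<beta> t (Idx (i + 1)) (Idx j) + entry \<mu> \<beta> t (Idx i) (Idx (j + 1))) (at t)"
    and "\<And>i j t. t \<in> I \<Longrightarrow>
          entry \<mu> \<beta> t (Idx (i + 1)) (Idx j) + entry \<mu> \<beta> t (Idx i) (Idx (j + 1)) =
          Pf \<mu> \<beta> t [D0, D1, Idx i, Idx j]"
    and "\<And>n t. t \<in> I \<Longrightarrow> tau \<mu> \<beta> n t \<noteq> 0"
  shows "\<forall>n\<ge>1. \<forall>t\<in>I.
      (toda_u \<mu> \<beta> n has_real_derivative
         toda_u \<mu> \<beta> n t * (toda_b \<mu> \<beta> (n + 1) t - 2 * toda_b \<mu> \<beta> n t + toda_b \<mu> \<beta> (n - 1) t)) (at t) \<and>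
      (toda_b \<mu> \<beta> n has_real_derivative
         toda_u \<mu> \<beta> n t * (toda_b \<mu> \<beta> (n - 1) t - toda_b \<mu> \<beta> (n + 1) t)) (at t)"
proof -
  \<comment> \<open>Passing to \<open>pf\<close> replaces a sum over 24 permutations by two row
    expansions.\<close>
  have Pf4: "Pf \<mu> \<beta> t [D0, D1, Idx i, Idx j] = \<beta> j t * \<beta> (Suc i) t - \<beta> i t * \<beta> (Suc j) t"
    if t: "t \<in> I" for i j t
  proof -
    have skew: "entry \<mu> \<beta> t x y = - entry \<mu> \<beta> t y x" for x y
      by (rule entry_skewI) (rule assms(5)[OF t])
    have "Pf \<mu> \<beta> t [D0, D1, Idx i, Idx j] = pf (entry \<mu> \<beta> t) [D0, D1, Idx i, Idx j]"
      unfolding Pf_def by (rule hirota_pf_eq_pf[OF skew]) simp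
    then show ?thesis by simp
  qed
  interpret bkp_moments I \<mu> \<beta>
  proof
    fix t i j assume t: "t \<in> I"
    show "\<mu> i j t = - \<mu> j i t" by (rule assms(5)[OF t])
    show "(\<beta> i has_real_derivative \<beta> (Suc i) t) (at t)"
      using assms(6)[OF t, of i] by simp
    show "(\<mu> i j has_real_derivative \<mu> (Suc i) j t + \<mu> i (Suc j) t) (at t)"
      using assms(8)[OF t, of i j] by simp
    show "(\<mu> i j has_real_derivative \<beta> j t * \<beta> (Suc i) t - \<beta> i t * \<beta> (Suc j) t) (at t)"
      using assms(8)[OF t, of i j] unfolding assms(9)[OF t] Pf4[OF t] by simp
  qed (rule assms(1))
  show ?thesis
    using toda_u_deriv toda_b_deriv assms(10) by blast
qed

end
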